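(* Consider an imprecise probability tree. Let $\mathcal{M}$ be a submartingale such that $\Delta\mathcal{M}$ is uniformly bounded, i.e. there is a real $B$ with $|\Delta\mathcal{M}(x_{1:n})(x_{n+1})|\leq B$ for all $n\in\mathbb{N}_0$, $x_{1:n}\in\mathcal{X}_{1:n}$ and $x_{n+1}\in\mathcal{X}_{n+1}$. Then $\liminf\langle\mathcal{M}\rangle\geq0$ strictly almost surely; that is, the event $\{\omega\in\Omega:\liminf_{n\to\infty}\langle\mathcal{M}\rangle(\omega^n)<0\}$ is strictly null.
   Context: Write $\mathbb{N}=\{1,2,\dots\}$ and $\mathbb{N}_0=\mathbb{N}\cup\{0\}$. For each $k\in\mathbb{N}$ let $\mathcal{X}_k$ be a non-empty finite set. A situation is a finite string $x_{1:n}=(x_1,\dots,x_n)\in\mathcal{X}_{1:n}:=\mathcal{X}_1\times\dots\times\mathcal{X}_n$ with $n\in\mathbb{N}_0$; the empty string ($n=0$) is denoted $\square$. A path is an element $\omega=(\omega_1,\omega_2,\dots)$ of $\Omega:=\prod_{k\in\mathbb{N}}\mathcal{X}_k$, and $\omega^n:=(\omega_1,\dots,\omega_n)$. An event is a subset of $\Omega$. A gamble on a set $Y$ is a bounded function $Y\to\mathbb{R}$; $\mathcal{G}(Y)$ is the set of all gambles on $Y$. A lower expectation on $\mathcal{G}(Y)$ is a functional $\underline{E}\colon\mathcal{G}(Y)\to\mathbb{R}$ with $\underline{E}(f)\geq\inf f$, $\underline{E}(f+g)\geq\underline{E}(f)+\underline{E}(g)$ and $\underline{E}(\lambda f)=\lambda\underline{E}(f)$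 for all gambles $f,g$ and real $\lambda\geq0$; its conjugate upper expectation is $\overline{E}(f):=-\underline{E}(-f)$. An imprecise probability tree attaches to each situation $x_{1:n}$ a lower expectation $\underline{Q}(\cdot|x_{1:n})$ on $\mathcal{G}(\mathcal{X}_{n+1})$, with conjugate $\overline{Q}(\cdot|x_{1:n})$. A real process $\mathcal{F}$ is a real-valued map on the set of situations; its difference is given by $\Delta\mathcal{F}(x_{1:n})(x_{n+1}):=\mathcal{F}(x_{1:n+1})-\mathcal{F}(x_{1:n})$. A submartingale is a real process $\mathcal{M}$ with $\underline{Q}(\Delta\mathcal{M}(x_{1:n})|x_{1:n})\geq0$ for all situations $x_{1:n}$; a supermartingale is a real process $\mathcal{M}$ with $\overline{Q}(\Delta\mathcal{M}(x_{1:n})|x_{1:n})\leq0$ for all situations. A test supermartingale is a supermartingale $\mathcal{T}$ with $\mathcal{T}(\square)=1$ and $\mathcal{T}(s)\geq0$ for all situations $s$. An event $A$ is strictly null if there is a test supermartingale $\mathcal{T}$ with $\lim_{n\to\infty}\mathcal{T}(\omega^n)=+\infty$ for all $\omega\in A$. A statement about paths holds strictly almost surely if the event that it fails is strictly null. The path-averaged process of a real process $\mathcal{F}$ is $\langle\mathcal{F}\rangle(\square):=0$ and $\langle\mathcal{F}\rangle(x_{1:n}):=\frac1n\sum_{k=0}^{n-1}\Delta\mathcal{F}(x_{1:k})(x_{k+1})$ for $n\geq1$; $\liminf\mathcal{F}(\omega):=\liminf_{n\to\infty}\mathcal{F}(\omega^n)$. *)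

theory Defs
  imports "HOL-Analysis.Analysis"
begin

text \<open>
  The state spaces are \<open>X 1, X 2, \<dots>\<close>; \<open>X 0\<close> is never used. They are subsets of one type, which may
  be any type and so does not restrict how they relate to each other. A situation is the list of its
  states, so the entry \<open>xs ! i\<close>, counted from 0, lies in \<open>X (Suc i)\<close>, and the state that follows
  \<open>xs\<close> lies in \<open>X (Suc (length xs))\<close>.
\<close>

definition situations :: "(nat \<Rightarrow> 'a set) \<Rightarrow> 'a list set" where
  "situations X = {xs. \<forall>i<length xs. xs ! i \<in> X (Suc i)}"

definition paths :: "(nat \<Rightarrow> 'a set) \<Rightarrow> (nat \<Rightarrow> 'a) set" where
  "paths X = (\<Pi>\<^sub>E k\<in>{1..}. X k)"

definition path_prefix :: "(nat \<Rightarrow> 'a) \<Rightarrow> nat \<Rightarrow> 'a list" where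
  "path_prefix \<omega> n = map \<omega> [1..<Suc n]"

text \<open>
  A gamble on \<open>Y\<close> is represented by any total function that is bounded on \<open>Y\<close>. Its values outside
  \<open>Y\<close> are irrelevant, also to a lower expectation: see \<open>lower_expectation_cong\<close> below. Hence the
  functionals below correspond exactly to the lower expectations on functions with domain \<open>Y\<close>.
\<close>

definition gambles :: "'a set \<Rightarrow> ('a \<Rightarrow> real) set" where
  "gambles Y = {f. bounded (f ` Y)}"

definition lower_expectation :: "'a set \<Rightarrow> (('a \<Rightarrow> real) \<Rightarrow> real) \<Rightarrow> bool" where
  "lower_expectation Y E \<longleftrightarrow>
     (\<forall>f\<in>gambles Y. (INF y\<in>Y. f y) \<le> E f) \<and>
     (\<forall>f\<in>gambles Y. \<forall>g\<in>gambles Y. E f + E g \<le> E (\<lambda>y. f y + g y)) \<and>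
     (\<forall>f\<in>gambles Y. \<forall>c\<ge>0. E (\<lambda>y. c * f y) = c * E f)"

definition conjugate :: "(('a \<Rightarrow> real) \<Rightarrow> real) \<Rightarrow> ('a \<Rightarrow> real) \<Rightarrow> real" where
  "conjugate E f = - E (\<lambda>y. - f y)"

lemma lower_expectation_cong:
  assumes E: "lower_expectation Y E" and ne: "Y \<noteq> {}"
    and f: "f \<in> gambles Y" and eq: "\<And>y. y \<in> Y \<Longrightarrow> f y = g y"
  shows "E f = E g"
proof -
  have le: "E v \<le> E u"
    if v: "v \<in> gambles Y" and uv: "\<And>y. y \<in> Y \<Longrightarrow> u y = v y" for u v
  proof -
    let ?d = "\<lambda>y. u y - v y"
    have "?d ` Y \<subseteq> {0}"
      using uv by auto
    then have d: "?d \<in> gambles Y"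
      unfolding gambles_def using bounded_subset[of "{0::real}"] by auto
    have "(INF y\<in>Y. ?d y) = (INF y\<in>Y. 0)"
      using uv by (intro INF_cong) auto
    then have "0 \<le> E ?d"
      using E d ne unfolding lower_expectation_def by (metis cINF_const)
    moreover have "E v + E ?d \<le> E (\<lambda>y. v y + ?d y)"
      using E v d unfolding lower_expectation_def by blast
    ultimately show ?thesis
      by simp
  qed
  have "g ` Y = f ` Y"
    using eq by force
  then have "g \<in> gambles Y"
    using f by (simp add: gambles_def)
  then show ?thesis
    using le[of f g] le[of g f] f eq by force
qed

definition imprecise_probability_tree ::
  "(nat \<Rightarrow> 'a set) \<Rightarrow> ('a list \<Rightarrow> ('a \<Rightarrow> real) \<Rightarrow> real) \<Rightarrow> bool" where
  "imprecise_probability_tree X Q \<longleftrightarrow>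
     (\<forall>k\<ge>1. finite (X k) \<and> X k \<noteq> {}) \<and>
     (\<forall>xs\<in>situations X. lower_expectation (X (Suc (length xs))) (Q xs))"

text \<open>
  A real process is a total function on lists of which only the values in situations matter.
\<close>

definition process_diff :: "('a list \<Rightarrow> real) \<Rightarrow> 'a list \<Rightarrow> 'a \<Rightarrow> real" where
  "process_diff F xs = (\<lambda>x. F (xs @ [x]) - F xs)"

definition submartingale ::
  "(nat \<Rightarrow> 'a set) \<Rightarrow> ('a list \<Rightarrow> ('a \<Rightarrow> real) \<Rightarrow> real) \<Rightarrow> ('a list \<Rightarrow> real) \<Rightarrow> bool" where
  "submartingale X Q M \<longleftrightarrow> (\<forall>xs\<in>situations X. 0 \<le> Q xs (process_diff M xs))"

definition supermartingale ::
  "(nat \<Rightarrow> 'a set) \<Rightarrow> ('a list \<Rightarrow> ('a \<Rightarrow> real) \<Rightarrow> real) \<Rightarrow> ('a list \<Rightarrow> real) \<Rightarrow> bool" where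
  "supermartingale X Q M \<longleftrightarrow> (\<forall>xs\<in>situations X. conjugate (Q xs) (process_diff M xs) \<le> 0)"

definition test_supermartingale ::
  "(nat \<Rightarrow> 'a set) \<Rightarrow> ('a list \<Rightarrow> ('a \<Rightarrow> real) \<Rightarrow> real) \<Rightarrow> ('a list \<Rightarrow> real) \<Rightarrow> bool" where
  "test_supermartingale X Q T \<longleftrightarrow>
     supermartingale X Q T \<and> T [] = 1 \<and> (\<forall>xs\<in>situations X. 0 \<le> T xs)"

definition strictly_null ::
  "(nat \<Rightarrow> 'a set) \<Rightarrow> ('a list \<Rightarrow> ('a \<Rightarrow> real) \<Rightarrow> real) \<Rightarrow> (nat \<Rightarrow> 'a) set \<Rightarrow> bool" where
  "strictly_null X Q A \<longleftrightarrow>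
     A \<subseteq> paths X \<and>
     (\<exists>T. test_supermartingale X Q T \<and>
          (\<forall>\<omega>\<in>A. filterlim (\<lambda>n. T (path_prefix \<omega> n)) at_top sequentially))"

definition strictly_almost_surely ::
  "(nat \<Rightarrow> 'a set) \<Rightarrow> ('a list \<Rightarrow> ('a \<Rightarrow> real) \<Rightarrow> real) \<Rightarrow> ((nat \<Rightarrow> 'a) \<Rightarrow> bool) \<Rightarrow> bool" where
  "strictly_almost_surely X Q P \<longleftrightarrow> strictly_null X Q {\<omega> \<in> paths X. \<not> P \<omega>}"

text \<open>
  For \<open>xs = x\<^sub>1 \<dots> x\<^sub>n\<close>, \<open>take k xs\<close> is \<open>x\<^sub>1 \<dots> x\<^sub>k\<close> and \<open>xs ! k\<close> is the state after it.
\<close>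

definition path_average :: "('a list \<Rightarrow> real) \<Rightarrow> 'a list \<Rightarrow> real" where
  "path_average F xs =
     (if xs = [] then 0
      else (1 / real (length xs)) * (\<Sum>k<length xs. process_diff F (take k xs) (xs ! k)))"

text \<open>The limit inferior is taken in the extended reals, where it always exists.\<close>

definition process_liminf :: "('a list \<Rightarrow> real) \<Rightarrow> (nat \<Rightarrow> 'a) \<Rightarrow> ereal" where
  "process_liminf F \<omega> = liminf (\<lambda>n. ereal (F (path_prefix \<omega> n)))"

end

theory Submission
  imports Defs
begin

text \<open>
  Write \<open>\<Delta>\<^sub>k\<close> for the increments of the submartingale \<open>M\<close> along a path, and let \<open>\<bar>\<Delta>\<^sub>k\<bar> \<le> B\<close> with
  \<open>B > 0\<close>. Betting a nonnegative stake \<open>c\<close> against \<open>M\<close>, that is, changing the capital by \<open>- c \<Delta>\<^sub>k\<close>,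
  never has positive upper expectation. Hence a capital process with start value 1 whose stakes
  never exceed the fraction \<open>1 / (2 B)\<close> of the current capital is a test supermartingale
  (\<open>test_supermartingale_if_betting\<close>).

  If the averages of \<open>\<Delta>\<^sub>1, \<dots>, \<Delta>\<^sub>n\<close> are below \<open>- r < 0\<close> for infinitely many \<open>n\<close>, then betting a
  sufficiently small constant fraction \<open>\<xi>\<close> of the capital produces the capital \<open>\<Prod>(1 - \<xi> \<Delta>\<^sub>k)\<close>, which
  by \<open>ln (1 + y) \<ge> y - 2 y\<^sup>2\<close> is at least \<open>exp (n \<xi> r / 2)\<close> for these \<open>n\<close>. This capital is unbounded
  along the path (\<open>unbounded_fixed_fraction\<close>), but need not tend to infinity.

  Two countable mixtures, with weights \<open>1/2, 1/4, 1/8, \<dots>\<close>, repair this. For one fraction, mixing the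
  capital processes that stop at the levels \<open>1, 2, 4, \<dots>\<close> puts aside \<open>1/2\<close> each time that a new level
  is reached, so that the mixture tends to infinity wherever the capital is unbounded
  (\<open>saving_tendsto_infinity\<close>). Mixing then over a sequence of fractions that tends to 0 covers all
  \<open>r > 0\<close> at once. Both mixtures are well defined and are again capital processes of the same kind
  (\<open>betting_mixture\<close>), because the bound on the stakes limits the capital after \<open>n\<close> steps to \<open>2 ^ n\<close>,
  uniformly over all these processes.
\<close>

section \<open>Situations and path prefixes\<close>

lemma situations_Nil [simp]: "[] \<in> situations X"
  by (simp add: situations_def)

lemma situations_snoc [simp]:
  "xs @ [x] \<in> situations X \<longleftrightarrow> xs \<in> situations X \<and> x \<in> X (Suc (length xs))"
  by (auto simp: situations_def nth_append less_Suc_eq)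

lemma length_path_prefix [simp]: "length (path_prefix \<omega> n) = n"
  by (simp add: path_prefix_def)

lemma path_prefix_Suc: "path_prefix \<omega> (Suc n) = path_prefix \<omega> n @ [\<omega> (Suc n)]"
  by (simp add: path_prefix_def)

lemma take_path_prefix: "k \<le> n \<Longrightarrow> take k (path_prefix \<omega> n) = path_prefix \<omega> k"
  by (simp add: path_prefix_def take_map take_upt del: upt_Suc)

lemma nth_path_prefix: "k < n \<Longrightarrow> path_prefix \<omega> n ! k = \<omega> (Suc k)"
  by (simp add: path_prefix_def del: upt_Suc)

lemma path_prefix_situations: "\<omega> \<in> paths X \<Longrightarrow> path_prefix \<omega> n \<in> situations X"
  by (auto simp: situations_def nth_path_prefix paths_def)

section \<open>Capital processes\<close>

text \<open>
  A capital process starts at 1 and bets, in each situation, a stake \<open>c \<ge> 0\<close> on a decrease of \<open>M\<close>; the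
  stake is at most the fraction \<open>1 / (2 B)\<close> of the current capital.
\<close>

definition betting ::
  "(nat \<Rightarrow> 'a set) \<Rightarrow> ('a list \<Rightarrow> real) \<Rightarrow> real \<Rightarrow> ('a list \<Rightarrow> real) \<Rightarrow> bool" where
  "betting X M B T \<longleftrightarrow> T [] = 1 \<and>
     (\<forall>xs\<in>situations X. \<exists>c\<ge>0. c * (2 * B) \<le> T xs \<and>
        (\<forall>x\<in>X (Suc (length xs)). T (xs @ [x]) = T xs - c * process_diff M xs x))"

text \<open>
  The increments of \<open>M\<close> are uniformly bounded by \<open>B\<close>. The bound is taken positive, so that the
  fraction \<open>1 / (2 B)\<close> makes sense.
\<close>

definition bounded_increments ::
  "(nat \<Rightarrow> 'a set) \<Rightarrow> ('a list \<Rightarrow> real) \<Rightarrow> real \<Rightarrow> bool" where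
  "bounded_increments X M B \<longleftrightarrow> 0 < B \<and>
     (\<forall>xs\<in>situations X. \<forall>x\<in>X (Suc (length xs)). \<bar>process_diff M xs x\<bar> \<le> B)"

lemma betting_Nil: "betting X M B T \<Longrightarrow> T [] = 1"
  by (simp add: betting_def)

lemma betting_bounds:
  assumes B: "bounded_increments X M B" and T: "betting X M B T"
    and xs: "xs \<in> situations X"
  shows "0 \<le> T xs \<and> T xs \<le> 2 ^ length xs"
  using xs
proof (induction xs rule: rev_induct)
  case Nil
  show ?case using betting_Nil[OF T] by simp
next
  case (snoc x xs)
  then have xs: "xs \<in> situations X" and x: "x \<in> X (Suc (length xs))" by auto
  obtain c where c: "0 \<le> c" "c * (2 * B) \<le> T xs"
    and eq: "T (xs @ [x]) = T xs - c * process_diff M xs x"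
    using T xs x unfolding betting_def by blast
  have "\<bar>process_diff M xs x\<bar> \<le> B"
    using B xs x unfolding bounded_increments_def by blast
  then have "\<bar>c * process_diff M xs x\<bar> \<le> c * B"
    using c(1) by (simp add: abs_mult mult_left_mono)
  then show ?case
    using eq c(2) snoc.IH[OF xs] by (simp add: abs_le_iff)
qed

lemma test_supermartingale_if_betting:
  assumes tree: "imprecise_probability_tree X Q" and M: "submartingale X Q M"
    and B: "bounded_increments X M B" and T: "betting X M B T"
  shows "test_supermartingale X Q T"
proof -
  have "conjugate (Q xs) (process_diff T xs) \<le> 0" if xs: "xs \<in> situations X" for xs
  proof -
    let ?Y = "X (Suc (length xs))"
    have fin: "finite ?Y" and ne: "?Y \<noteq> {}" and E: "lower_expectation ?Y (Q xs)"
      using tree xs unfolding imprecise_probability_tree_def by auto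
    obtain c where c: "0 \<le> c"
      and eq: "\<forall>x\<in>?Y. T (xs @ [x]) = T xs - c * process_diff M xs x"
      using T xs unfolding betting_def by blast
    have gamble: "f \<in> gambles ?Y" for f
      using fin by (simp add: gambles_def finite_imp_bounded)
    have "Q xs (\<lambda>x. - process_diff T xs x) = Q xs (\<lambda>x. c * process_diff M xs x)"
      using eq by (intro lower_expectation_cong[OF E ne gamble]) (simp add: process_diff_def)
    also have "\<dots> = c * Q xs (process_diff M xs)"
      using E c gamble unfolding lower_expectation_def by blast
    also have "\<dots> \<ge> 0"
      using M xs c unfolding submartingale_def by simp
    finally show ?thesis by (simp add: conjugate_def)
  qed
  then show ?thesis
    using betting_bounds[OF B T] betting_Nil[OF T]
    unfolding test_supermartingale_def supermartingale_def by blast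
qed

section \<open>Countable mixtures\<close>

text \<open>
  The initial capital 1 is divided over the processes \<open>T 0, T 1, \<dots>\<close> in the parts \<open>1/2, 1/4, \<dots>\<close>.
\<close>

definition mixture :: "(nat \<Rightarrow> 'a list \<Rightarrow> real) \<Rightarrow> 'a list \<Rightarrow> real" where
  "mixture T xs = (\<Sum>i. (1/2) ^ Suc i * T i xs)"

lemma summable_half_power_mult:
  fixes a :: "nat \<Rightarrow> real"
  assumes "\<And>i. 0 \<le> a i" and "\<And>i. a i \<le> K"
  shows "summable (\<lambda>i. (1/2) ^ Suc i * a i)"
proof (rule summable_comparison_test)
  show "summable (\<lambda>i. (1/2) ^ Suc i * K)"
    using power_half_series by (intro summable_mult2) (rule sums_summable)
  show "\<exists>N. \<forall>n\<ge>N. norm ((1/2) ^ Suc n * a n) \<le> (1/2) ^ Suc n * K"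
    using assms by (intro exI allI impI) (simp add: abs_mult)
qed

lemma summable_mixture:
  assumes "bounded_increments X M B" "\<And>i. betting X M B (T i)" "xs \<in> situations X"
  shows "summable (\<lambda>i. (1/2) ^ Suc i * T i xs)"
  using betting_bounds[OF assms(1,2,3)] by (intro summable_half_power_mult) auto

text \<open>
  The mixed stakes are the stakes of the mixed capital. This needs no continuity of the lower
  expectations, because every single gamble is a multiple of the same increment of \<open>M\<close>.
\<close>

lemma betting_mixture:
  assumes B: "bounded_increments X M B" and T: "\<And>i. betting X M B (T i)"
  shows "betting X M B (mixture T)"
  unfolding betting_def
proof (intro conjI ballI)
  show "mixture T [] = 1"
    using power_half_series betting_Nil[OF T] by (simp add: mixture_def sums_iff)
next
  fix xs assume xs: "xs \<in> situations X"
  have pos: "0 < B" using B by (simp add: bounded_increments_def)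
  have "\<forall>i. \<exists>c\<ge>0. c * (2 * B) \<le> T i xs \<and>
      (\<forall>x\<in>X (Suc (length xs)). T i (xs @ [x]) = T i xs - c * process_diff M xs x)"
    using T xs unfolding betting_def by blast
  then obtain c where c: "\<And>i. 0 \<le> c i" "\<And>i. c i * (2 * B) \<le> T i xs"
    and eq: "\<And>i x. x \<in> X (Suc (length xs)) \<Longrightarrow>
      T i (xs @ [x]) = T i xs - c i * process_diff M xs x"
    by metis
  have "c i \<le> 2 ^ length xs / (2 * B)" for i
    using c(2)[of i] betting_bounds[OF B T xs, of i] pos by (simp add: field_simps)
  then have sc: "summable (\<lambda>i. (1/2) ^ Suc i * c i)"
    using c(1) by (intro summable_half_power_mult)
  note sT = summable_mixture[OF B T xs]
  let ?c = "\<Sum>i. (1/2) ^ Suc i * c i"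
  have "0 \<le> ?c"
    using c(1) by (intro suminf_nonneg[OF sc]) simp
  moreover have "?c * (2 * B) \<le> mixture T xs"
  proof -
    have "?c * (2 * B) = (\<Sum>i. (1/2) ^ Suc i * c i * (2 * B))"
      by (rule suminf_mult2[OF sc])
    also have "\<dots> \<le> mixture T xs"
      unfolding mixture_def
    proof (rule suminf_le[OF _ summable_mult2[OF sc] sT])
      show "(1/2) ^ Suc i * c i * (2 * B) \<le> (1/2) ^ Suc i * T i xs" for i
        using mult_left_mono[OF c(2)[of i], of "(1/2) ^ Suc i"] by (simp add: mult.assoc)
    qed
    finally show ?thesis .
  qed
  moreover have "mixture T (xs @ [x]) = mixture T xs - ?c * process_diff M xs x"
    if x: "x \<in> X (Suc (length xs))" for x
  proof -
    have "mixture T (xs @ [x]) =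
        (\<Sum>i. (1/2) ^ Suc i * T i xs - (1/2) ^ Suc i * c i * process_diff M xs x)"
      unfolding mixture_def eq[OF x] by (simp add: right_diff_distrib mult.assoc)
    also have "\<dots> = mixture T xs - (\<Sum>i. (1/2) ^ Suc i * c i * process_diff M xs x)"
      unfolding mixture_def by (rule suminf_diff[OF sT summable_mult2[OF sc], symmetric])
    finally show ?thesis
      by (simp only: suminf_mult2[OF sc])
  qed
  ultimately show "\<exists>c\<ge>0. c * (2 * B) \<le> mixture T xs \<and>
      (\<forall>x\<in>X (Suc (length xs)). mixture T (xs @ [x]) = mixture T xs - c * process_diff M xs x)"
    by blast
qed

lemma sum_le_mixture:
  assumes B: "bounded_increments X M B" and T: "\<And>i. betting X M B (T i)"
    and xs: "xs \<in> situations X" and I: "finite I"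
  shows "(\<Sum>i\<in>I. (1/2) ^ Suc i * T i xs) \<le> mixture T xs"
  unfolding mixture_def
  using betting_bounds[OF B T xs] by (intro sum_le_suminf[OF summable_mixture[OF B T xs] I]) simp

section \<open>Stopping and saving\<close>

text \<open>
  The process \<open>T\<close> stopped when it first reaches the level \<open>c\<close>. The first disjunct makes the least
  index at most the length of \<open>xs\<close>, so the value is \<open>T xs\<close> if the level has not been reached yet.
\<close>

definition stopped :: "('a list \<Rightarrow> real) \<Rightarrow> real \<Rightarrow> 'a list \<Rightarrow> real" where
  "stopped T c xs = T (take (LEAST k. length xs \<le> k \<or> c \<le> T (take k xs)) xs)"

lemma stopped_unreached:
  assumes "\<And>k. k < length xs \<Longrightarrow> T (take k xs) < c"
  shows "stopped T c xs = T xs"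
proof -
  have "(LEAST k. length xs \<le> k \<or> c \<le> T (take k xs)) = length xs"
    using assms by (intro Least_equality) (auto simp: not_le[symmetric])
  then show ?thesis by (simp add: stopped_def)
qed

lemma stopped_reached_snoc:
  assumes k: "k \<le> length xs" "c \<le> T (take k xs)"
  shows "stopped T c (xs @ [x]) = stopped T c xs"
proof -
  define l where "l = (LEAST k. c \<le> T (take k xs))"
  have l: "c \<le> T (take l xs)" and least: "\<And>j. c \<le> T (take j xs) \<Longrightarrow> l \<le> j"
    unfolding l_def using k(2) by (auto intro: LeastI Least_le)
  have len: "l \<le> length xs"
    using least[OF k(2)] k(1) by simp
  have "(LEAST k. length (xs @ [x]) \<le> k \<or> c \<le> T (take k (xs @ [x]))) = l"
  proof (rule Least_equality)
    fix j assume j: "length (xs @ [x]) \<le> j \<or> c \<le> T (take j (xs @ [x]))"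
    show "l \<le> j"
    proof (cases "j \<le> length xs")
      case True
      then show ?thesis using j by (auto intro: least)
    qed (use len in simp)
  qed (use l len in simp)
  moreover have "(LEAST k. length xs \<le> k \<or> c \<le> T (take k xs)) = l"
    using l len least by (intro Least_equality) auto
  ultimately show ?thesis
    using len by (simp add: stopped_def)
qed

lemma le_stopped:
  assumes k: "k \<le> length xs" "c \<le> T (take k xs)"
  shows "c \<le> stopped T c xs"
proof -
  define l where "l = (LEAST k. length xs \<le> k \<or> c \<le> T (take k xs))"
  have "length xs \<le> l \<or> c \<le> T (take l xs)"
    unfolding l_def by (rule LeastI[of _ k]) (use k in simp)
  moreover have "l \<le> k"
    unfolding l_def by (rule Least_le) (use k in simp)
  ultimately have "c \<le> T (take l xs)"
    using k by (metis dual_order.trans le_antisym)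
  then show ?thesis by (simp add: stopped_def l_def)
qed

lemma betting_stopped:
  assumes B: "bounded_increments X M B" and T: "betting X M B T"
  shows "betting X M B (stopped T c)"
  unfolding betting_def
proof (intro conjI ballI)
  show "stopped T c [] = 1"
    using betting_Nil[OF T] by (simp add: stopped_def)
next
  fix xs assume xs: "xs \<in> situations X"
  show "\<exists>d\<ge>0. d * (2 * B) \<le> stopped T c xs \<and> (\<forall>x\<in>X (Suc (length xs)).
      stopped T c (xs @ [x]) = stopped T c xs - d * process_diff M xs x)"
  proof (cases "\<exists>k\<le>length xs. c \<le> T (take k xs)")
    case True
    have "take k xs \<in> situations X" for k
      using xs by (simp add: situations_def)
    then have "0 \<le> stopped T c xs"
      using betting_bounds[OF B T] by (simp add: stopped_def)
    then show ?thesis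
      using True stopped_reached_snoc[of _ xs c T] by (intro exI[of _ 0]) auto
  next
    case False
    then have below: "T (take k xs) < c" if "k \<le> length xs" for k
      using that False not_le by blast
    then have "stopped T c xs = T xs" "\<And>x. stopped T c (xs @ [x]) = T (xs @ [x])"
      by (auto intro!: stopped_unreached)
    then show ?thesis
      using T xs unfolding betting_def by simp
  qed
qed

text \<open>
  The capital is divided over accounts that all bet as \<open>T\<close> does, where account \<open>i\<close> stops at the
  level \<open>2 ^ i\<close>. As account \<open>i\<close> has weight \<open>(1/2) ^ (i + 1)\<close>, it then holds at least \<open>1/2\<close> for ever.
\<close>

definition saving :: "('a list \<Rightarrow> real) \<Rightarrow> 'a list \<Rightarrow> real" where
  "saving T = mixture (\<lambda>i. stopped T (2 ^ i))"

lemma betting_saving: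
  "bounded_increments X M B \<Longrightarrow> betting X M B T \<Longrightarrow> betting X M B (saving T)"
  unfolding saving_def by (intro betting_mixture betting_stopped)

lemma saving_tendsto_infinity:
  assumes B: "bounded_increments X M B" and T: "betting X M B T" and \<omega>: "\<omega> \<in> paths X"
    and unbounded: "\<And>K. \<exists>n. K \<le> T (path_prefix \<omega> n)"
  shows "filterlim (\<lambda>n. saving T (path_prefix \<omega> n)) at_top sequentially"
  unfolding filterlim_at_top
proof
  fix Z :: real
  obtain N :: nat where N: "2 * Z \<le> real N"
    using real_arch_simple by blast
  have "\<forall>\<^sub>F n in sequentially. 2 ^ i \<le> stopped T (2 ^ i) (path_prefix \<omega> n)" for i
  proof -
    obtain m where m: "2 ^ i \<le> T (path_prefix \<omega> m)"
      using unbounded by blast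
    show ?thesis
      using eventually_ge_at_top[of m]
    proof eventually_elim
      case (elim n)
      then show ?case
        using m by (intro le_stopped[of m]) (simp_all add: take_path_prefix)
    qed
  qed
  then have "\<forall>\<^sub>F n in sequentially. \<forall>i\<in>{..<N}. 2 ^ i \<le> stopped T (2 ^ i) (path_prefix \<omega> n)"
    by (intro eventually_ball_finite) auto
  then show "\<forall>\<^sub>F n in sequentially. Z \<le> saving T (path_prefix \<omega> n)"
  proof eventually_elim
    case (elim n)
    have "Z \<le> (\<Sum>i<N. 1/2)"
      using N by simp
    also have "\<dots> \<le> (\<Sum>i<N. (1/2) ^ Suc i * stopped T (2 ^ i) (path_prefix \<omega> n))"
    proof (rule sum_mono)
      fix i assume "i \<in> {..<N}"
      then have "(1/2) ^ Suc i * 2 ^ i \<le> (1/2) ^ Suc i * stopped T (2 ^ i) (path_prefix \<omega> n)"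
        using elim by (intro mult_left_mono) auto
      then show "1/2 \<le> (1/2) ^ Suc i * stopped T (2 ^ i) (path_prefix \<omega> n)"
        by (simp add: power_divide)
    qed
    also have "\<dots> \<le> saving T (path_prefix \<omega> n)"
      unfolding saving_def
      by (intro sum_le_mixture[OF B betting_stopped[OF B T] path_prefix_situations[OF \<omega>]]) simp
    finally show ?case .
  qed
qed

section \<open>Betting a fixed fraction of the capital\<close>

text \<open>The capital process in which every stake is \<open>\<xi>\<close> times the current capital.\<close>

definition fixed_fraction :: "('a list \<Rightarrow> real) \<Rightarrow> real \<Rightarrow> 'a list \<Rightarrow> real" where
  "fixed_fraction M \<xi> xs = (\<Prod>k<length xs. 1 - \<xi> * process_diff M (take k xs) (xs ! k))"

lemma fixed_fraction_snoc:
  "fixed_fraction M \<xi> (xs @ [x]) = fixed_fraction M \<xi> xs * (1 - \<xi> * process_diff M xs x)"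
  by (simp add: fixed_fraction_def nth_append)

lemma betting_fixed_fraction:
  assumes B: "bounded_increments X M B" and \<xi>: "0 \<le> \<xi>" "\<xi> * (2 * B) \<le> 1"
  shows "betting X M B (fixed_fraction M \<xi>)"
proof -
  have nonneg: "0 \<le> fixed_fraction M \<xi> xs" if "xs \<in> situations X" for xs
    using that
  proof (induction xs rule: rev_induct)
    case Nil
    show ?case by (simp add: fixed_fraction_def)
  next
    case (snoc x xs)
    then have "\<bar>process_diff M xs x\<bar> \<le> B"
      using B unfolding bounded_increments_def by simp
    then have "\<xi> * process_diff M xs x \<le> \<xi> * B"
      using \<xi>(1) by (intro mult_left_mono) auto
    also have "\<dots> \<le> 1"
      using \<xi>(2) B \<xi>(1) mult_nonneg_nonneg[of \<xi> B] by (simp add: bounded_increments_def)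
    finally show ?case
      using snoc by (simp add: fixed_fraction_snoc)
  qed
  have "\<exists>c\<ge>0. c * (2 * B) \<le> fixed_fraction M \<xi> xs \<and> (\<forall>x\<in>X (Suc (length xs)).
      fixed_fraction M \<xi> (xs @ [x]) = fixed_fraction M \<xi> xs - c * process_diff M xs x)"
    if xs: "xs \<in> situations X" for xs
    using nonneg[OF xs] \<xi> mult_left_mono[OF \<xi>(2) nonneg[OF xs]]
    by (intro exI[of _ "fixed_fraction M \<xi> xs * \<xi>"])
       (auto simp: fixed_fraction_snoc algebra_simps)
  then show ?thesis
    by (simp add: betting_def fixed_fraction_def)
qed

lemma exp_le_prod_one_minus:
  fixes d :: "nat \<Rightarrow> real"
  assumes "0 \<le> \<xi>" and "\<xi> * (2 * B) \<le> 1" and "\<And>k. k < n \<Longrightarrow> \<bar>d k\<bar> \<le> B"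
  shows "exp (- \<xi> * (\<Sum>k<n. d k) - real n * (2 * (\<xi> * B)\<^sup>2)) \<le> (\<Prod>k<n. 1 - \<xi> * d k)"
proof -
  have factor: "exp (- \<xi> * d k - 2 * (\<xi> * B)\<^sup>2) \<le> 1 - \<xi> * d k" if "k < n" for k
  proof -
    have le: "\<bar>\<xi> * d k\<bar> \<le> \<xi> * B"
      using assms(1) assms(3)[OF that] by (simp add: abs_mult mult_left_mono)
    then have half: "\<bar>- \<xi> * d k\<bar> \<le> 1/2"
      using assms(2) by simp
    have "(\<xi> * d k)\<^sup>2 \<le> (\<xi> * B)\<^sup>2"
      using le power_mono[OF le, of 2] by simp
    moreover have "- \<xi> * d k - 2 * (\<xi> * d k)\<^sup>2 \<le> ln (1 + - \<xi> * d k)"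
      using abs_ln_one_plus_x_minus_x_bound[OF half] by (simp add: abs_le_iff)
    ultimately have "- \<xi> * d k - 2 * (\<xi> * B)\<^sup>2 \<le> ln (1 - \<xi> * d k)"
      by simp
    moreover have "0 < 1 - \<xi> * d k"
      using half by (simp add: abs_le_iff)
    ultimately show ?thesis
      by (metis exp_le_cancel_iff exp_ln)
  qed
  have "exp (- \<xi> * (\<Sum>k<n. d k) - real n * (2 * (\<xi> * B)\<^sup>2)) =
      exp (\<Sum>k<n. - \<xi> * d k - 2 * (\<xi> * B)\<^sup>2)"
    by (simp add: sum_subtractf sum_negf sum_distrib_left)
  also have "\<dots> = (\<Prod>k<n. exp (- \<xi> * d k - 2 * (\<xi> * B)\<^sup>2))"
    by (simp add: exp_sum)
  also have "\<dots> \<le> (\<Prod>k<n. 1 - \<xi> * d k)"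
    using factor by (intro prod_mono) auto
  finally show ?thesis .
qed

lemma unbounded_fixed_fraction:
  assumes B: "bounded_increments X M B" and \<omega>: "\<omega> \<in> paths X"
    and \<xi>: "0 < \<xi>" "\<xi> * (2 * B) \<le> 1" and r: "0 < r" "4 * \<xi> * B\<^sup>2 \<le> r"
    and freq: "\<exists>\<^sub>F n in sequentially. path_average M (path_prefix \<omega> n) \<le> - r"
  shows "\<exists>n. K \<le> fixed_fraction M \<xi> (path_prefix \<omega> n)"
proof -
  have "filterlim (\<lambda>n. exp (\<xi> * r / 2 * real n)) at_top sequentially"
    using \<xi>(1) r(1)
    by (intro filterlim_compose[OF exp_at_top] filterlim_tendsto_pos_mult_at_top[OF tendsto_const]
        filterlim_real_sequentially) simp
  then have "\<forall>\<^sub>F n in sequentially. K \<le> exp (\<xi> * r / 2 * real n)"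
    by (simp add: filterlim_at_top)
  then obtain n where avg: "path_average M (path_prefix \<omega> n) \<le> - r"
    and K: "K \<le> exp (\<xi> * r / 2 * real n)"
    using frequently_ex[OF frequently_eventually_frequently[OF freq]] by blast
  define d where "d k = process_diff M (path_prefix \<omega> k) (\<omega> (Suc k))" for k
  have d: "\<bar>d k\<bar> \<le> B" for k
    using B path_prefix_situations[OF \<omega>, of "Suc k"]
    unfolding d_def bounded_increments_def by (simp add: path_prefix_Suc)
  have n: "0 < n"
    using avg r(1) by (cases n) (auto simp: path_average_def path_prefix_def)
  then have "path_prefix \<omega> n \<noteq> []"
    by (metis length_path_prefix list.size(3) less_irrefl)
  then have "path_average M (path_prefix \<omega> n) = (\<Sum>k<n. d k) / real n"
    by (simp add: path_average_def d_def take_path_prefix nth_path_prefix)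
  then have sum: "(\<Sum>k<n. d k) \<le> - r * real n"
    using avg n by (simp only: pos_divide_le_eq of_nat_0_less_iff)
  \<comment> \<open>The second-order loss \<open>2 \<xi>\<^sup>2 B\<^sup>2\<close> per step is at most half of the average gain \<open>\<xi> r\<close>.\<close>
  have "\<xi> * (4 * \<xi> * B\<^sup>2) \<le> \<xi> * r"
    using \<xi>(1) r(2) by (intro mult_left_mono) auto
  then have "2 * (\<xi> * B)\<^sup>2 \<le> \<xi> * r / 2"
    by (simp add: power2_eq_square algebra_simps)
  then have "real n * (2 * (\<xi> * B)\<^sup>2) \<le> real n * (\<xi> * r / 2)"
    by (rule mult_left_mono) simp
  moreover have "\<xi> * (\<Sum>k<n. d k) \<le> \<xi> * (- r * real n)"
    using sum \<xi>(1) by (intro mult_left_mono) auto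
  ultimately have "\<xi> * r / 2 * real n \<le> - \<xi> * (\<Sum>k<n. d k) - real n * (2 * (\<xi> * B)\<^sup>2)"
    by (simp add: algebra_simps)
  then have "K \<le> exp (- \<xi> * (\<Sum>k<n. d k) - real n * (2 * (\<xi> * B)\<^sup>2))"
    using K by (meson exp_le_cancel_iff order_trans)
  also have "\<dots> \<le> (\<Prod>k<n. 1 - \<xi> * d k)"
    using \<xi> d by (intro exp_le_prod_one_minus) auto
  also have "\<dots> = fixed_fraction M \<xi> (path_prefix \<omega> n)"
    by (simp add: fixed_fraction_def d_def take_path_prefix nth_path_prefix)
  finally show ?thesis by blast
qed

section \<open>The strong law for submartingale differences\<close>

lemma frequently_le_if_liminf_neg:
  assumes "\<not> 0 \<le> process_liminf F \<omega>"
  obtains r where "0 < r" "\<exists>\<^sub>F n in sequentially. F (path_prefix \<omega> n) \<le> - r"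
proof -
  obtain y where y: "y < 0" "\<exists>\<^sub>F n in sequentially. ereal (F (path_prefix \<omega> n)) \<le> y"
    using assms unfolding process_liminf_def le_Liminf_iff
    by (auto simp: not_eventually not_less)
  obtain z where z: "y < ereal z" "ereal z < 0"
    using ereal_dense2[OF y(1)] by auto
  have "\<exists>\<^sub>F n in sequentially. F (path_prefix \<omega> n) \<le> - (- z)"
    using y(2)
  proof (rule frequently_elim1)
    fix n assume "ereal (F (path_prefix \<omega> n)) \<le> y"
    then have "ereal (F (path_prefix \<omega> n)) \<le> ereal z"
      using z(1) by (meson order.strict_implies_order order_trans)
    then show "F (path_prefix \<omega> n) \<le> - (- z)" by simp
  qed
  then show ?thesis
    using that[of "- z"] z(2) by simp
qed

theorem corollary8:
  fixes X :: "nat \<Rightarrow> 'a set"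
    and Q :: "'a list \<Rightarrow> ('a \<Rightarrow> real) \<Rightarrow> real"
    and M :: "'a list \<Rightarrow> real"
  assumes "imprecise_probability_tree X Q"
    and "submartingale X Q M"
    and "\<exists>B::real. \<forall>xs\<in>situations X. \<forall>x\<in>X (Suc (length xs)). \<bar>process_diff M xs x\<bar> \<le> B"
  shows "strictly_almost_surely X Q (\<lambda>\<omega>. 0 \<le> process_liminf (path_average M) \<omega>)"
proof -
  obtain B0 where B0: "\<forall>xs\<in>situations X. \<forall>x\<in>X (Suc (length xs)). \<bar>process_diff M xs x\<bar> \<le> B0"
    using assms(3) by blast
  define B where "B = max B0 1"
  have B: "bounded_increments X M B"
    using B0 unfolding bounded_increments_def B_def by (auto simp: le_max_iff_disj)
  then have pos: "0 < B" by (simp add: bounded_increments_def)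
  define \<xi> where "\<xi> j = 1 / (2 * B * real (Suc j))" for j
  define V where "V j = fixed_fraction M (\<xi> j)" for j
  have \<xi>: "0 < \<xi> j" "\<xi> j * (2 * B) \<le> 1" for j
    using pos by (simp_all add: \<xi>_def)
  have V: "betting X M B (V j)" for j
    unfolding V_def using \<xi>[of j] by (intro betting_fixed_fraction[OF B]) auto
  let ?T = "mixture (\<lambda>j. saving (V j))"
  have "filterlim (\<lambda>n. ?T (path_prefix \<omega> n)) at_top sequentially"
    if \<omega>: "\<omega> \<in> paths X" and neg: "\<not> 0 \<le> process_liminf (path_average M) \<omega>" for \<omega>
  proof -
    obtain r where r: "0 < r" "\<exists>\<^sub>F n in sequentially. path_average M (path_prefix \<omega> n) \<le> - r"
      using frequently_le_if_liminf_neg[OF neg] .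
    obtain j :: nat where j: "2 * B / r \<le> real j"
      using real_arch_simple by blast
    have "4 * \<xi> j * B\<^sup>2 = 2 * B / real (Suc j)"
      using pos by (simp add: \<xi>_def power2_eq_square divide_simps)
    also have "\<dots> \<le> r"
    proof -
      have "2 * B \<le> r * real j"
        using j r(1) by (simp add: field_simps)
      also have "\<dots> \<le> r * real (Suc j)"
        using r(1) by simp
      finally show ?thesis by (simp add: field_simps)
    qed
    finally have small: "4 * \<xi> j * B\<^sup>2 \<le> r" .
    have "filterlim (\<lambda>n. saving (V j) (path_prefix \<omega> n)) at_top sequentially"
      unfolding V_def
      by (intro saving_tendsto_infinity[OF B V[unfolded V_def] \<omega>]
          unbounded_fixed_fraction[OF B \<omega> \<xi> r(1) small r(2)])
    then have "filterlim (\<lambda>n. (1/2) ^ Suc j * saving (V j) (path_prefix \<omega> n)) at_top sequentially"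
      by (intro filterlim_tendsto_pos_mult_at_top[OF tendsto_const]) auto
    then show ?thesis
    proof (rule filterlim_at_top_mono, intro always_eventually allI)
      show "(1/2) ^ Suc j * saving (V j) (path_prefix \<omega> n) \<le> ?T (path_prefix \<omega> n)" for n
        using sum_le_mixture[OF B betting_saving[OF B V] path_prefix_situations[OF \<omega>], of "{j}"]
        by simp
    qed
  qed
  moreover have "test_supermartingale X Q ?T"
    by (intro test_supermartingale_if_betting[OF assms(1,2) B] betting_mixture[OF B]
        betting_saving[OF B] V)
  ultimately show ?thesis
    unfolding strictly_almost_surely_def strictly_null_def by blast
qed

end
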